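(* Let $(T,\vdash,\dashv,\perp)$ be a triassociative algebra and let $x=x_1\ast x_2\ast\cdots\ast x_n$ be a product of elements $x_1,\dots,x_n\in T$, with any choice of parentheses, where each occurrence of $\ast$ is one of $\vdash,\dashv,\perp$ (the occurrences may be different operations). Then $x$ can be written in the form $$(x_1\vdash x_2\vdash\cdots\vdash x_{n_1-1})\vdash(x_{n_1}\dashv\cdots\dashv x_{n_2-1})\perp(x_{n_2}\dashv\cdots\dashv x_{n_3-1})\perp\cdots\perp(x_{n_r}\dashv\cdots\dashv x_n)$$ for some $1\le n_1\le n_2\le\cdots\le n_r\le n$.
   Context: A triassociative algebra $(T,\vdash,\dashv,\perp)$ is a vector space $T$ over a field with three bilinear products $\vdash,\dashv,\perp:T\times T\to T$ satisfying, for all $x,y,z\in T$: (A1) $(x\vdash y)\vdash z=x\vdash(y\vdash z)$; (A2) $(x\dashv y)\dashv z=x\dashv(y\dashv z)$; (D1) $(x\dashv y)\vdash z=x\vdash(y\vdash z)$; (D2) $(x\dashv y)\dashv z=x\dashv(y\vdash z)$; (S1) $(x\vdash y)\dashv z=x\vdash(y\dashv z)$; (T1) $(x\perp y)\vdash z=x\vdash(y\vdash z)$; (T2) $(x\dashv y)\dashv z=x\dashv(y\perp z)$; (T3) $(x\vdash y)\perp z=x\vdash(y\perp z)$; (T4) $(x\perp y)\dashv z=x\perp(y\dashv z)$; (S2) $(x\dashv y)\perp z=x\perp(y\vdash z)$; (A3) $(x\perp y)\perp z=x\perp(y\perp z)$. Conventions for the displayed form: $r\ge 1$. Each of $\vdash,\dashv,\perp$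 is associative, so no parentheses are needed inside each bracketed factor or among the $\perp$-joined factors; the whole expression is unambiguous because $(a\vdash b)\perp c=a\vdash(b\perp c)$. A bracketed factor that contains no elements (the first one when $n_1=1$, or a later one when $n_i=n_{i+1}$) is omitted together with the adjacent operation symbol. When $r=1$ there is a single $\dashv$-factor $(x_{n_1}\dashv\cdots\dashv x_n)$. *)

theory Defs
  imports Complex_Main
begin

definition bilinear_op :: "('k::field \<Rightarrow> 'a::ab_group_add \<Rightarrow> 'a) \<Rightarrow> ('a \<Rightarrow> 'a \<Rightarrow> 'a) \<Rightarrow> bool"
  where "bilinear_op scale f \<longleftrightarrow>
    (\<forall>y. Vector_Spaces.linear scale scale (\<lambda>x. f x y)) \<and>
    (\<forall>x. Vector_Spaces.linear scale scale (\<lambda>y. f x y))"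

locale triassociative_algebra = vector_space scale
  for scale :: "'k::field \<Rightarrow> 'a::ab_group_add \<Rightarrow> 'a" +
  fixes vd :: "'a \<Rightarrow> 'a \<Rightarrow> 'a" (infixl "\<turnstile>" 70)
    and dv :: "'a \<Rightarrow> 'a \<Rightarrow> 'a" (infixl "\<stileturn>" 70)
    and pp :: "'a \<Rightarrow> 'a \<Rightarrow> 'a" (infixl "\<bottom>" 70)
  assumes bilinear_vd: "bilinear_op scale (\<turnstile>)"
    and bilinear_dv: "bilinear_op scale (\<stileturn>)"
    and bilinear_pp: "bilinear_op scale (\<bottom>)"
    and A1: "(x \<turnstile> y) \<turnstile> z = x \<turnstile> (y \<turnstile> z)"
    and A2: "(x \<stileturn> y) \<stileturn> z = x \<stileturn> (y \<stileturn> z)"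
    and D1: "(x \<stileturn> y) \<turnstile> z = x \<turnstile> (y \<turnstile> z)"
    and D2: "(x \<stileturn> y) \<stileturn> z = x \<stileturn> (y \<turnstile> z)"
    and S1: "(x \<turnstile> y) \<stileturn> z = x \<turnstile> (y \<stileturn> z)"
    and T1: "(x \<bottom> y) \<turnstile> z = x \<turnstile> (y \<turnstile> z)"
    and T2: "(x \<stileturn> y) \<stileturn> z = x \<stileturn> (y \<bottom> z)"
    and T3: "(x \<turnstile> y) \<bottom> z = x \<turnstile> (y \<bottom> z)"
    and T4: "(x \<bottom> y) \<stileturn> z = x \<bottom> (y \<stileturn> z)"
    and S2: "(x \<stileturn> y) \<bottom> z = x \<bottom> (y \<turnstile> z)"
    and A3: "(x \<bottom> y) \<bottom> z = x \<bottom> (y \<bottom> z)"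

text \<open>A product with a choice of parentheses and of an operation at each occurrence of
  the product sign is a binary tree; its elements, read from left to right, are the factors.\<close>

datatype tri_op = VDash | DashV | Perp

datatype 'a tri_product = Elem 'a | Prod tri_op "'a tri_product" "'a tri_product"

primrec elements :: "'a tri_product \<Rightarrow> 'a list" where
  "elements (Elem a) = [a]"
| "elements (Prod c s t) = elements s @ elements t"

primrec tri_value ::
  "('a \<Rightarrow> 'a \<Rightarrow> 'a) \<Rightarrow> ('a \<Rightarrow> 'a \<Rightarrow> 'a) \<Rightarrow> ('a \<Rightarrow> 'a \<Rightarrow> 'a) \<Rightarrow> 'a tri_product \<Rightarrow> 'a" where
  "tri_value vd dv pp (Elem a) = a"
| "tri_value vd dv pp (Prod c s t) =
    (case c of VDash \<Rightarrow> vd | DashV \<Rightarrow> dv | Perp \<Rightarrow> pp)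
      (tri_value vd dv pp s) (tri_value vd dv pp t)"

text \<open>The product of a nonempty list under one operation, bracketed to the left; it is only
  used for associative operations. Its value on the empty list is meaningless.\<close>

definition chain :: "('a \<Rightarrow> 'a \<Rightarrow> 'a) \<Rightarrow> 'a list \<Rightarrow> 'a"
  where "chain f xs = foldl f (hd xs) (tl xs)"

text \<open>For \<open>ns = [n\<^sub>1, \<dots>, n\<^sub>r]\<close>, the lists
  \<open>[x n\<^sub>i, \<dots>, x (n\<^sub>i\<^sub>+\<^sub>1 - 1)]\<close> for \<open>1 \<le> i \<le> r\<close>, where \<open>n\<^sub>r\<^sub>+\<^sub>1 = n + 1\<close>.
  Such a list is empty if \<open>n\<^sub>i = n\<^sub>i\<^sub>+\<^sub>1\<close>.\<close>

definition blocks :: "(nat \<Rightarrow> 'a) \<Rightarrow> nat \<Rightarrow> nat list \<Rightarrow> 'a list list"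
  where "blocks x n ns = map (\<lambda>(i, j). map x [i..<j]) (zip ns (tl ns @ [n + 1]))"

text \<open>Empty factors are omitted. The factors joined by \<open>pp\<close> are grouped together first,
  which by axiom \<open>T3\<close> is immaterial. If \<open>n\<^sub>1 = n\<^sub>2\<close>, the operation symbol omitted with the
  empty first \<open>dv\<close>-factor is the \<open>pp\<close> to its right, so the leading \<open>vd\<close>-factor
  remains attached by \<open>vd\<close>.\<close>

definition tri_form ::
  "('a \<Rightarrow> 'a \<Rightarrow> 'a) \<Rightarrow> ('a \<Rightarrow> 'a \<Rightarrow> 'a) \<Rightarrow> ('a \<Rightarrow> 'a \<Rightarrow> 'a) \<Rightarrow> (nat \<Rightarrow> 'a) \<Rightarrow> nat \<Rightarrow> nat list \<Rightarrow> 'a"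
  where "tri_form vd dv pp x n ns =
    (let prefix = map x [1..<hd ns];
         tail = chain pp (map (chain dv) (filter (\<lambda>b. b \<noteq> []) (blocks x n ns)))
     in if prefix = [] then tail else vd (chain vd prefix) tail)"

end

theory Submission
  imports Defs
begin

text \<open>The dash of \<open>\<turnstile>\<close> and \<open>\<stileturn>\<close> points to the factor whose structure survives. In a product
  \<open>s \<turnstile> z\<close> only the sequence of elements of \<open>s\<close> matters, by \<open>A1\<close>, \<open>D1\<close> and \<open>T1\<close>, and
  in \<open>z \<stileturn> s\<close> likewise, by \<open>A2\<close>, \<open>D2\<close> and \<open>T2\<close> (lemmas \<open>value_vd\<close>, \<open>dv_value\<close>).
  The remaining axioms let an operation act on a normal form, that is, on a word \<open>P\<close>
  joined by \<open>\<turnstile>\<close> in front of a \<open>\<bottom>\<close>-product of \<open>\<stileturn>\<close>-blocks: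
  \<open>S1\<close> and \<open>T4\<close> carry an element multiplied on the right by \<open>\<stileturn>\<close> into the last
  block, \<open>T3\<close> and \<open>A3\<close> let \<open>\<bottom>\<close> add further blocks at the end, and \<open>S2\<close> turns
  a word that is to be put by \<open>\<turnstile>\<close> in front of the right factor of \<open>\<bottom>\<close> into a word appended by \<open>\<stileturn>\<close> to the left factor.

  Hence normal forms with data \<open>(P, B)\<close> and \<open>(Q, C)\<close> multiply as follows. Under \<open>\<turnstile>\<close> the
  left factor dissolves into the word \<open>P @ concat B @ Q\<close>, and the blocks \<open>C\<close> stay. Under
  \<open>\<stileturn>\<close> the right factor dissolves into the last block of \<open>B\<close>. Under \<open>\<bottom>\<close> the
  word \<open>Q\<close> joins the last block of \<open>B\<close>, and the blocks \<open>C\<close> follow. The order of the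
  elements is kept each time, so induction on the product yields a normal form with
  nonempty blocks (\<open>normal_form_exists\<close>). The starting positions of the blocks are the indices
  \<open>n\<^sub>1 < \<dots> < n\<^sub>r\<close>.\<close>

section \<open>Products of lists under one operation\<close>

lemma chain_singleton [simp]: "chain f [a] = a"
  by (simp add: chain_def)

lemma chain_append: "xs \<noteq> [] \<Longrightarrow> chain f (xs @ ys) = foldl f (chain f xs) ys"
  by (cases xs) (simp_all add: chain_def)

lemma foldl_assoc:
  assumes "\<And>a b c. f (f a b) c = f a (f b c)"
  shows "foldl f (f a b) xs = f a (foldl f b xs)"
  by (induction xs arbitrary: b) (simp_all add: assms)

lemma chain_append_assoc:
  assumes "\<And>a b c. f (f a b) c = f a (f b c)" and "xs \<noteq> []" and "ys \<noteq> []"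
  shows "chain f (xs @ ys) = f (chain f xs) (chain f ys)"
  using assms(2,3) foldl_assoc[OF assms(1)]
  by (cases ys) (simp_all add: chain_append chain_def)

lemma foldl_assoc_foldr:
  assumes "\<And>a b c. f (f a b) c = f a (f b c)"
  shows "f (foldl f a xs) z = f a (foldr f xs z)"
  by (induction xs arbitrary: a) (simp_all add: assms)

lemma chain_assoc_foldr:
  assumes "\<And>a b c. f (f a b) c = f a (f b c)" and "xs \<noteq> []"
  shows "f (chain f xs) z = foldr f xs z"
  using assms(2) foldl_assoc_foldr[OF assms(1)]
  by (cases xs) (simp_all add: chain_def)

section \<open>Normal forms\<close>

context triassociative_algebra
begin

text \<open>The right fold over \<open>P\<close> is the value of the word \<open>P\<close> under \<open>\<turnstile>\<close>, multiplied by
  \<open>\<turnstile>\<close> with what follows it; unlike a \<open>chain\<close> it allows \<open>P\<close> to be empty.\<close>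

definition normal_form :: "'a list \<Rightarrow> 'a list list \<Rightarrow> 'a" where
  "normal_form P B = foldr (\<turnstile>) P (chain (\<bottom>) (map (chain (\<stileturn>)) B))"

abbreviation tri_val :: "'a tri_product \<Rightarrow> 'a" where
  "tri_val \<equiv> tri_value (\<turnstile>) (\<stileturn>) (\<bottom>)"

text \<open>To the left of \<open>\<turnstile>\<close> all three operations have the effect of \<open>\<turnstile>\<close>:
  \<open>A1\<close>, \<open>D1\<close> and \<open>T1\<close> have the same right-hand side.\<close>

lemma value_vd: "tri_val t \<turnstile> z = foldr (\<turnstile>) (elements t) z"
proof (induction t arbitrary: z)
  case (Prod c s t)
  have "tri_val (Prod c s t) \<turnstile> z = tri_val s \<turnstile> (tri_val t \<turnstile> z)"
    by (cases c) (simp_all add: A1 D1 T1)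
  then show ?case by (simp only: Prod.IH elements.simps foldr_append comp_apply)
qed simp

text \<open>Dually, \<open>A2\<close>, \<open>D2\<close> and \<open>T2\<close> have the same left-hand side.\<close>

lemma dv_value: "z \<stileturn> tri_val t = foldl (\<stileturn>) z (elements t)"
proof (induction t arbitrary: z)
  case (Prod c s t)
  have "z \<stileturn> tri_val (Prod c s t) = (z \<stileturn> tri_val s) \<stileturn> tri_val t"
    by (cases c) (simp_all flip: A2 D2 T2)
  then show ?case by (simp only: Prod.IH elements.simps foldl_append)
qed simp

lemma foldr_vd_dv: "foldr (\<turnstile>) P y \<stileturn> z = foldr (\<turnstile>) P (y \<stileturn> z)"
  by (induction P) (simp_all add: S1)

lemma foldr_vd_pp: "foldr (\<turnstile>) P y \<bottom> z = foldr (\<turnstile>) P (y \<bottom> z)"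
  by (induction P) (simp_all add: T3)

text \<open>By \<open>S2\<close>, elements change sides of \<open>\<bottom>\<close> one at a time.\<close>

lemma pp_foldr_vd: "y \<bottom> foldr (\<turnstile>) Q z = foldl (\<stileturn>) y Q \<bottom> z"
  by (induction Q arbitrary: y) (simp_all add: S2[symmetric])

text \<open>One element multiplied on the right by \<open>\<stileturn>\<close> moves past the leading word by \<open>S1\<close> and
  past all blocks but the last by \<open>T4\<close>.\<close>

lemma normal_form_dv_last:
  assumes "c \<noteq> []"
  shows "normal_form P (B @ [c]) \<stileturn> z = normal_form P (B @ [c @ [z]])"
  using assms
  by (cases "B = []") (simp_all add: normal_form_def foldr_vd_dv chain_append T4)

lemma normal_form_foldl_dv:
  assumes "c \<noteq> []"
  shows "foldl (\<stileturn>) (normal_form P (B @ [c])) zs = normal_form P (B @ [c @ zs])"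
  using assms
  by (induction zs arbitrary: c) (simp_all add: normal_form_dv_last)

lemma normal_form_pp:
  assumes "c \<noteq> []" and "C \<noteq> []"
  shows "normal_form P (B @ [c]) \<bottom> normal_form Q C = normal_form P (B @ [c @ Q] @ C)"
proof -
  have "normal_form P (B @ [c]) \<bottom> normal_form Q C
      = normal_form P (B @ [c @ Q]) \<bottom> chain (\<bottom>) (map (chain (\<stileturn>)) C)"
    using assms(1) normal_form_foldl_dv[of c P B Q]
    by (simp add: normal_form_def[of Q C] pp_foldr_vd)
  also have "\<dots> = normal_form P (B @ [c @ Q] @ C)"
    using assms(2)
      chain_append_assoc[of "(\<bottom>)" "map (chain (\<stileturn>)) (B @ [c @ Q])" "map (chain (\<stileturn>)) C"]
    by (simp add: normal_form_def foldr_vd_pp A3)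
  finally show ?thesis .
qed

text \<open>The last block \<open>c\<close> is kept apart from the others because \<open>\<stileturn>\<close> and \<open>\<bottom>\<close> extend
  it. All blocks are nonempty; this is why the last one starts at position \<open>n\<close> at the
  latest and why the deletion of empty blocks in \<open>tri_form\<close> changes nothing.\<close>

lemma normal_form_exists:
  "\<exists>P B c. tri_val t = normal_form P (B @ [c]) \<and> P @ concat (B @ [c]) = elements t
    \<and> [] \<notin> set (B @ [c])"
proof (induction t)
  case (Elem a)
  have "tri_val (Elem a) = normal_form [] ([] @ [[a]])"
    by (simp add: normal_form_def)
  then show ?case by fastforce
next
  case (Prod k s t)
  obtain P B c where s: "tri_val s = normal_form P (B @ [c])"
    "P @ concat (B @ [c]) = elements s" "[] \<notin> set (B @ [c])"
    using Prod.IH(1) by blast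
  obtain Q C d where t: "tri_val t = normal_form Q (C @ [d])"
    "Q @ concat (C @ [d]) = elements t" "[] \<notin> set (C @ [d])"
    using Prod.IH(2) by blast
  have c: "c \<noteq> []" using s(3) by auto
  show ?case
  proof (cases k)
    case VDash
    have "tri_val s \<turnstile> tri_val t = normal_form (elements s @ Q) (C @ [d])"
      by (simp add: value_vd) (simp add: t(1) normal_form_def)
    then have "tri_val (Prod k s t) = normal_form (elements s @ Q) (C @ [d])"
      using VDash by simp
    moreover have "(elements s @ Q) @ concat (C @ [d]) = elements (Prod k s t)"
      using t(2) by simp
    ultimately show ?thesis
      using t(3) by (intro exI conjI)
  next
    case DashV
    have "tri_val s \<stileturn> tri_val t = normal_form P (B @ [c @ elements t])"
      by (simp only: dv_value s(1) normal_form_foldl_dv[OF c])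
    then have "tri_val (Prod k s t) = normal_form P (B @ [c @ elements t])"
      using DashV by simp
    moreover have "P @ concat (B @ [c @ elements t]) = elements (Prod k s t)"
      using s(2) by auto
    moreover have "[] \<notin> set (B @ [c @ elements t])"
      using s(3) by auto
    ultimately show ?thesis by (intro exI conjI)
  next
    case Perp
    have "tri_val s \<bottom> tri_val t = normal_form P ((B @ [c @ Q] @ C) @ [d])"
      using normal_form_pp[OF c, of "C @ [d]" P B Q] by (simp add: s(1) t(1))
    then have "tri_val (Prod k s t) = normal_form P ((B @ [c @ Q] @ C) @ [d])"
      using Perp by simp
    moreover have "P @ concat ((B @ [c @ Q] @ C) @ [d]) = elements (Prod k s t)"
      by (simp flip: s(2) t(2))
    moreover have "[] \<notin> set ((B @ [c @ Q] @ C) @ [d])"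
      using s(3) t(3) by auto
    ultimately show ?thesis by (intro exI conjI)
  qed
qed

end

section \<open>Blocks and their starting positions\<close>

primrec block_starts :: "nat \<Rightarrow> 'a list list \<Rightarrow> nat list" where
  "block_starts k [] = []"
| "block_starts k (b # B) = k # block_starts (k + length b) B"

lemma hd_block_starts: "B \<noteq> [] \<Longrightarrow> hd (block_starts k B) = k"
  by (cases B) simp_all

lemma block_starts_Nil_iff [simp]: "block_starts k B = [] \<longleftrightarrow> B = []"
  by (cases B) simp_all

lemma block_starts_ge: "i \<in> set (block_starts k B) \<Longrightarrow> k \<le> i"
  by (induction B arbitrary: k) (auto dest: add_leD1)

lemma sorted_block_starts: "sorted (block_starts k B)"
  by (induction B arbitrary: k) (auto dest: block_starts_ge add_leD1)

lemma block_starts_less: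
  assumes "[] \<notin> set B" and "i \<in> set (block_starts k B)"
  shows "i < k + length (concat B)"
  using assms by (induction B arbitrary: k) (fastforce simp: add.assoc)+

lemma append_eq_map_upt:
  assumes "xs @ ys = map x [k..<m]" and "k \<le> m"
  shows "xs = map x [k..<k + length xs] \<and> ys = map x [k + length xs..<m] \<and> k + length xs \<le> m"
proof -
  have le: "k + length xs \<le> m"
    using arg_cong[OF assms(1), of length] assms(2) by simp
  have "xs = take (length xs) (map x [k..<m])" "ys = drop (length xs) (map x [k..<m])"
    by (simp_all flip: assms(1))
  then show ?thesis
    using le by (simp add: take_map drop_map)
qed

lemma blocks_block_starts:
  assumes "concat B = map x [k..<n + 1]" and "k \<le> n + 1"
  shows "blocks x n (block_starts k B) = B"
  using assms
proof (induction B arbitrary: k)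
  case Nil
  then show ?case by (simp add: blocks_def)
next
  case (Cons b B)
  note split = append_eq_map_upt[of b "concat B" x k "n + 1"]
  have b: "map x [k..<k + length b] = b" "concat B = map x [k + length b..<n + 1]"
    "k + length b \<le> n + 1"
    using split Cons.prems by auto
  show ?case
  proof (cases B)
    case Nil
    \<comment> \<open>The last block ends at \<open>n\<close>, the index that \<open>blocks\<close> appends being \<open>n + 1\<close>.\<close>
    then show ?thesis using Cons.prems by (simp add: blocks_def)
  next
    case (Cons b' B')
    then show ?thesis
      using Cons.IH[OF b(2,3)] b(1) by (simp add: blocks_def)
  qed
qed

section \<open>Every product has a normal form\<close>

theorem proposition4p2:
  fixes scale :: "'k::field \<Rightarrow> 'a::ab_group_add \<Rightarrow> 'a"
    and vd dv pp :: "'a \<Rightarrow> 'a \<Rightarrow> 'a"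
    and x :: "nat \<Rightarrow> 'a" and n :: nat and t :: "'a tri_product"
  assumes "triassociative_algebra scale vd dv pp"
    and "elements t = map x [1..<n + 1]"
  shows "\<exists>ns. ns \<noteq> [] \<and> 1 \<le> hd ns \<and> sorted ns \<and> last ns \<le> n \<and>
    tri_value vd dv pp t = tri_form vd dv pp x n ns"
proof -
  interpret triassociative_algebra scale vd dv pp by (fact assms(1))
  obtain P B where val: "tri_value vd dv pp t = normal_form P B"
    and els: "P @ concat B = map x [1..<n + 1]" and ne: "[] \<notin> set B" "B \<noteq> []"
    using normal_form_exists[of t] assms(2) by (metis append_is_Nil_conv not_Cons_self2)
  let ?k = "1 + length P"
  let ?ns = "block_starts ?k B"
  note split = append_eq_map_upt[OF els]
  have P: "map x [1..<?k] = P" and B: "concat B = map x [?k..<n + 1]" and k: "?k \<le> n + 1"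
    using split by auto
  have ns: "?ns \<noteq> []" "hd ?ns = ?k"
    using ne(2) by (simp_all add: hd_block_starts)
  have "last ?ns < ?k + length (concat B)"
    using block_starts_less[OF ne(1)] ns(1) by (meson last_in_set)
  then have last: "last ?ns \<le> n"
    using arg_cong[OF B, of length] k by (simp del: upt_Suc)
  have filter: "filter (\<lambda>b. b \<noteq> []) (blocks x n ?ns) = B"
    unfolding blocks_block_starts[OF B k] filter_id_conv using ne(1) by auto
  have "tri_form vd dv pp x n ?ns = normal_form P B"
    unfolding tri_form_def filter ns(2) P Let_def normal_form_def
    by (simp add: chain_assoc_foldr A1)
  then have "tri_value vd dv pp t = tri_form vd dv pp x n ?ns"
    using val by simp
  then show ?thesis
    using ns last sorted_block_starts[of ?k B] by (intro exI[of _ ?ns]) simp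
qed

end
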